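(* Let $(X,d,\mu)$ be a metric measure space, $1<p<\infty$, $1\le q<\infty$, $x_0\in X$ and $r_0>0$. If $X$ supports a $(q,p)$-Poincaré inequality within $B(x_0,r_0)$, with constants $C_{\rm PI}$ and $\lambda$, then the completion $\widehat X$ supports a $(q,p)$-Poincaré inequality within $\widehat B(x_0,r_0)$, with the same constants.
   Context: $X=(X,d,\mu)$ is a metric space with a positive complete Borel measure $\mu$ such that $0<\mu(B)<\infty$ for all balls $B$. Balls are open, $B(x,r)=\{y\in X:d(x,y)<r\}$; a ball $B$ comes with a predetermined centre and radius $r_B$, and $\lambda B$ is the concentric ball with radius $\lambda r_B$. Write $u_B=\frac1{\mu(B)}\int_B u\,d\mu$. $\widehat X$ is the completion of $X$ with respect to $d$ (the extended metric is also called $d$), and $\widehat B(x,r)=\{y\in\widehat X:d(x,y)<r\}$. A set $E\subset\widehat X$ is measurable iff $E\cap X$ is $\mu$-measurable, and $\mu$ is extended by $\mu(E)=\mu(E\cap X)$, so $\mu(\widehat X\setminus X)=0$. Upper gradients: curves are nonconstant, compact and rectifiable, parameterized by arc length. A Borel function $g:X\to[0,\infty]$ is an upper gradient of $f:X\to[-\infty,\infty]$ if $|f(\gamma(0))-f(\gamma(l_\gamma))|\le\int_\gamma g\,ds$ for all curves $\gamma:[0,l_\gamma]\to X$ (left-hand side $=\infty$ if at least one term is infinite). $(q,p)$-Poincaré inequality within $B(x_0,r_0)$ with constants $C>0$ and $\lambda\ge1$: for all balls $B\subset B(x_0,r_0)$, all integrable functions $u$ on $\lambda B$ and all upper gradients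 $g$ of $u$, $\bigl(\frac1{\mu(B)}\int_B|u-u_B|^q\,d\mu\bigr)^{1/q}\le Cr_B\bigl(\frac1{\mu(\lambda B)}\int_{\lambda B}g^p\,d\mu\bigr)^{1/p}$. The same definition is used on $\widehat X$, with balls and upper gradients of $\widehat X$. *)

theory Defs
  imports "HOL-Analysis.Analysis"
begin

section \<open>Metric measure spaces and completions\<close>

text \<open>The carrier of the metric space is a whole type, so every set is a subset of
  \<open>space M = UNIV\<close>. The sigma-algebra may be strictly larger than the completion of the
  Borel sigma-algebra.\<close>

definition metric_measure_space :: "'a::metric_space measure \<Rightarrow> bool" where
  "metric_measure_space M \<longleftrightarrow>
     space M = UNIV \<and> sets borel \<subseteq> sets M \<and> complete_measure M \<and>
     (\<forall>x r. 0 < r \<longrightarrow> 0 < emeasure M (ball x r) \<and> emeasure M (ball x r) < \<infinity>)"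

text \<open>The completion is determined up to isometry as a complete space containing an isometric
  dense copy of the original space; completeness is the class constraint on \<open>'b\<close>.\<close>

definition is_completion :: "('a::metric_space \<Rightarrow> 'b::complete_space) \<Rightarrow> bool" where
  "is_completion \<iota> \<longleftrightarrow> (\<forall>x y. dist (\<iota> x) (\<iota> y) = dist x y) \<and> closure (range \<iota>) = UNIV"

text \<open>With \<open>X\<close> identified with \<open>range \<iota>\<close>, the preimage \<open>\<iota> -` E\<close> is \<open>E \<inter> X\<close>.\<close>

definition extended_measure :: "('a \<Rightarrow> 'b) \<Rightarrow> 'a measure \<Rightarrow> 'b measure" where
  "extended_measure \<iota> M =
     measure_of UNIV {E. \<iota> -` E \<inter> space M \<in> sets M} (\<lambda>E. emeasure M (\<iota> -` E \<inter> space M))"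

text \<open>\<^const>\<open>measure_of\<close> yields a junk value unless its arguments form a measure space; the
  following facts show that they do.\<close>

lemma sigma_algebra_extended:
  "sigma_algebra UNIV {E. \<iota> -` E \<inter> space M \<in> sets M}"
proof (rule sigma_algebra_iff2[THEN iffD2], intro conjI ballI allI impI)
  show "{E. \<iota> -` E \<inter> space M \<in> sets M} \<subseteq> Pow UNIV" by simp
  show "{} \<in> {E. \<iota> -` E \<inter> space M \<in> sets M}" by simp
next
  fix E assume "E \<in> {E. \<iota> -` E \<inter> space M \<in> sets M}"
  then have "space M - (\<iota> -` E \<inter> space M) \<in> sets M" by blast
  moreover have "space M - (\<iota> -` E \<inter> space M) = \<iota> -` (UNIV - E) \<inter> space M" by blast
  ultimately show "UNIV - E \<in> {E. \<iota> -` E \<inter> space M \<in> sets M}" by simp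
next
  fix A :: "nat \<Rightarrow> _" assume "range A \<subseteq> {E. \<iota> -` E \<inter> space M \<in> sets M}"
  then have "(\<Union>i. \<iota> -` A i \<inter> space M) \<in> sets M" by blast
  moreover have "(\<Union>i. \<iota> -` A i \<inter> space M) = \<iota> -` (\<Union>i. A i) \<inter> space M" by blast
  ultimately show "(\<Union>i. A i) \<in> {E. \<iota> -` E \<inter> space M \<in> sets M}" by simp
qed

lemma space_extended_measure [simp]: "space (extended_measure \<iota> M) = UNIV"
  by (simp add: extended_measure_def)

lemma sets_extended_measure:
  "sets (extended_measure \<iota> M) = {E. \<iota> -` E \<inter> space M \<in> sets M}"
  unfolding extended_measure_def
  by (simp add: sigma_algebra.sets_measure_of_eq[OF sigma_algebra_extended])

lemma emeasure_extended_measure: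
  assumes E: "\<iota> -` E \<inter> space M \<in> sets M"
  shows "emeasure (extended_measure \<iota> M) E = emeasure M (\<iota> -` E \<inter> space M)"
  unfolding extended_measure_def
proof (rule emeasure_measure_of_sigma)
  let ?A = "{E. \<iota> -` E \<inter> space M \<in> sets M}"
  let ?m = "\<lambda>E. emeasure M (\<iota> -` E \<inter> space M)"
  show "sigma_algebra UNIV ?A" by (rule sigma_algebra_extended)
  show "positive ?A ?m" by (simp add: positive_def)
  show "countably_additive ?A ?m"
  proof (rule countably_additiveI)
    fix A :: "nat \<Rightarrow> _" assume A: "range A \<subseteq> ?A" "disjoint_family A"
    have "(\<Sum>i. ?m (A i)) = emeasure M (\<Union>i. \<iota> -` A i \<inter> space M)"
      using A by (intro suminf_emeasure) (auto simp: disjoint_family_on_def)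
    also have "(\<Union>i. \<iota> -` A i \<inter> space M) = \<iota> -` (\<Union>i. A i) \<inter> space M" by blast
    finally show "(\<Sum>i. ?m (A i)) = ?m (\<Union>i. A i)" .
  qed
  show "E \<in> ?A" using E by simp
qed

section \<open>Curves and upper gradients\<close>

definition curve_length :: "(real \<Rightarrow> 'a::metric_space) \<Rightarrow> real \<Rightarrow> real \<Rightarrow> ennreal" where
  "curve_length \<gamma> a b =
     (SUP (n, t) \<in> {(n::nat, t::nat \<Rightarrow> real). mono_on {..n} t \<and> t ` {..n} \<subseteq> {a..b}}.
        \<Sum>i<n. ennreal (dist (\<gamma> (t i)) (\<gamma> (t (Suc i)))))"

text \<open>A curve is its arc length parametrization on \<open>{0..l}\<close>, with \<open>l\<close> its (finite) length;
  \<open>0 < l\<close> says that it is nonconstant. Values outside \<open>{0..l}\<close> are irrelevant.\<close>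

definition arc_length_curve :: "(real \<Rightarrow> 'a::metric_space) \<Rightarrow> real \<Rightarrow> bool" where
  "arc_length_curve \<gamma> l \<longleftrightarrow>
     0 < l \<and> continuous_on {0..l} \<gamma> \<and>
     (\<forall>t\<in>{0..l}. curve_length \<gamma> 0 t = ennreal t)"

text \<open>\<open>\<bar>a - b\<bar>\<close>, taken to be infinite as soon as one of the terms is.\<close>

definition ext_diff :: "ereal \<Rightarrow> ereal \<Rightarrow> ennreal" where
  "ext_diff a b = (if \<bar>a\<bar> = \<infinity> \<or> \<bar>b\<bar> = \<infinity> then \<infinity> else e2ennreal \<bar>a - b\<bar>)"

definition upper_gradient :: "('a::metric_space \<Rightarrow> ennreal) \<Rightarrow> ('a \<Rightarrow> ereal) \<Rightarrow> bool" where
  "upper_gradient g f \<longleftrightarrow>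
     g \<in> borel_measurable borel \<and>
     (\<forall>\<gamma> l. arc_length_curve \<gamma> l \<longrightarrow>
        ext_diff (f (\<gamma> 0)) (f (\<gamma> l)) \<le> (\<integral>\<^sup>+t\<in>{0..l}. g (\<gamma> t) \<partial>lborel))"

section \<open>Poincare inequalities\<close>

text \<open>Only used with exponents \<open>a > 0\<close>.\<close>

definition ennpowr :: "ennreal \<Rightarrow> real \<Rightarrow> ennreal" where
  "ennpowr x a = (if x = \<infinity> then \<infinity> else ennreal (enn2real x powr a))"

definition integrable_over :: "'a measure \<Rightarrow> 'a set \<Rightarrow> ('a \<Rightarrow> ereal) \<Rightarrow> bool" where
  "integrable_over M A u \<longleftrightarrow>
     u \<in> borel_measurable (restrict_space M A) \<and> (\<integral>\<^sup>+x\<in>A. e2ennreal \<bar>u x\<bar> \<partial>M) < \<infinity>"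

text \<open>For \<open>u\<close> integrable over \<open>A\<close>, the set where \<open>u\<close> is infinite is null in \<open>A\<close>, so the value
  given to \<open>u\<close> there by \<^const>\<open>real_of_ereal\<close> does not matter.\<close>

definition mean :: "'a measure \<Rightarrow> 'a set \<Rightarrow> ('a \<Rightarrow> ereal) \<Rightarrow> real" where
  "mean M A u = (LINT x:A|M. real_of_ereal (u x)) / measure M A"

definition nn_mean :: "'a measure \<Rightarrow> 'a set \<Rightarrow> ('a \<Rightarrow> ennreal) \<Rightarrow> ennreal" where
  "nn_mean M A f = (\<integral>\<^sup>+x\<in>A. f x \<partial>M) / emeasure M A"

text \<open>A ball is given by its centre \<open>x\<close> and radius \<open>r\<close>, which the set \<open>ball x r\<close> need not
  determine. The function \<open>u\<close> is defined on the whole space, as upper gradients require, but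
  integrability is only imposed on the dilated ball.\<close>

definition poincare_within ::
  "'a::metric_space measure \<Rightarrow> real \<Rightarrow> real \<Rightarrow> real \<Rightarrow> real \<Rightarrow> 'a \<Rightarrow> real \<Rightarrow> bool" where
  "poincare_within M q p C \<Lambda> x\<^sub>0 r\<^sub>0 \<longleftrightarrow>
     0 < C \<and> 1 \<le> \<Lambda> \<and>
     (\<forall>x r u g. 0 < r \<and> ball x r \<subseteq> ball x\<^sub>0 r\<^sub>0 \<and>
        integrable_over M (ball x (\<Lambda> * r)) u \<and> upper_gradient g u \<longrightarrow>
        ennpowr (nn_mean M (ball x r)
            (\<lambda>y. ennpowr (ext_diff (u y) (ereal (mean M (ball x r) u))) q)) (1 / q)
        \<le> ennreal (C * r) *
            ennpowr (nn_mean M (ball x (\<Lambda> * r)) (\<lambda>y. ennpowr (g y) p)) (1 / p))"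

end

theory Submission
  imports Defs
begin

text \<open>Since \<open>X\<close> carries all the mass and its curves are curves in the completion, a ball of the
  completion centred in \<open>X\<close> inherits the inequality from its trace on \<open>X\<close>. A ball \<open>B(x, r)\<close> with
  arbitrary centre is exhausted by the balls \<open>B(y, r - d(x, y))\<close> as \<open>y \<in> X\<close> tends to \<open>x\<close>; their
  dilations stay inside the dilation of \<open>B(x, r)\<close> because \<open>\<Lambda> \<ge> 1\<close>. The averages and measures
  converge by dominated convergence, and Fatou's lemma passes the left-hand side to the limit.\<close>

section \<open>Powers and differences of extended values\<close>

lemma ennpowr_ennreal: "0 \<le> t \<Longrightarrow> ennpowr (ennreal t) a = ennreal (t powr a)"
  by (simp add: ennpowr_def)

lemma ennpowr_top [simp]: "ennpowr \<infinity> a = \<infinity>" "ennpowr top a = \<infinity>"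
  by (simp_all add: ennpowr_def)

lemma ennpowr_mono:
  assumes "0 < a" "x \<le> y" shows "ennpowr x a \<le> ennpowr y a"
  using assms
  by (cases x; cases y) (auto simp: ennpowr_ennreal top_unique intro!: ennreal_leI powr_mono2)

text \<open>Used to clear the exponent \<open>1 / q\<close> before integrals are compared and to
  restore it afterwards. The value \<open>\<infinity>\<close> is fixed by both powers.\<close>

lemma ennpowr_ennpowr_inverse:
  assumes "a * b = 1" shows "ennpowr (ennpowr x a) b = x"
  using assms by (cases x) (auto simp: ennpowr_ennreal powr_powr)

lemma tendsto_ennpowr:
  assumes f: "(f \<longlongrightarrow> L) F" and L: "L < \<infinity>" and a: "0 < a"
  shows "((\<lambda>x. ennpowr (f x) a) \<longlongrightarrow> ennpowr L a) F"
proof -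
  have fin: "\<forall>\<^sub>F x in F. f x < \<infinity>" using order_tendstoD(2)[OF f L] .
  have "((\<lambda>x. enn2real (f x)) \<longlongrightarrow> enn2real L) F"
    using f L by (intro tendsto_enn2real) auto
  then have "((\<lambda>x. ennreal (enn2real (f x) powr a)) \<longlongrightarrow> ennreal (enn2real L powr a)) F"
    \<comment> \<open>The limit may be 0, where positivity of the exponent is what gives convergence
      of the powers.\<close>
    using a by (intro tendsto_ennrealI tendsto_powr') auto
  then have "((\<lambda>x. ennpowr (f x) a) \<longlongrightarrow> ennreal (enn2real L powr a)) F"
    by (rule Lim_transform_eventually) (use fin in eventually_elim, simp add: ennpowr_def)
  moreover have "ennpowr L a = ennreal (enn2real L powr a)" using L by (auto simp: ennpowr_def)
  ultimately show ?thesis by simp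
qed

lemma divide_le_posD_ennreal:
  fixes x y e :: ennreal
  assumes "x / e \<le> y" "0 < e" "e < \<infinity>"
  shows "x \<le> e * y"
proof -
  have "x = e * (x / e)" using assms by (auto simp: ennreal_times_divide mult.commute[of e x] mult_divide_eq_ennreal)
  also have "\<dots> \<le> e * y" using assms by (intro mult_left_mono) auto
  finally show ?thesis .
qed

text \<open>Inversion is continuous on all of \<open>ennreal\<close>, even at 0 and
  \<open>\<infinity>\<close>, and so is multiplication by a finite constant. Meant for averages with
  a fixed numerator whose denominator is the measure of a moving ball.\<close>

lemma tendsto_cdivide_ennreal:
  fixes c :: ennreal
  assumes f: "(f \<longlongrightarrow> L) F" and c: "c < \<infinity>"
  shows "((\<lambda>x. c / f x) \<longlongrightarrow> c / L) F"
proof -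
  have "continuous_on UNIV (inverse :: ennreal \<Rightarrow> ennreal)"
    using continuous_on_inverse_ennreal[OF continuous_on_id] .
  then have "((\<lambda>x. inverse (f x)) \<longlongrightarrow> inverse L) F"
    by (rule continuous_on_tendsto_compose) (use f in auto)
  then show ?thesis
    unfolding divide_ennreal_def using c by (intro ennreal_tendsto_cmult) auto
qed

lemma measurable_ennpowr [measurable]:
  assumes [measurable]: "f \<in> borel_measurable M"
  shows "(\<lambda>x. ennpowr (f x) a) \<in> borel_measurable M"
  unfolding ennpowr_def by measurable

lemma measurable_ext_diff [measurable]:
  assumes [measurable]: "f \<in> borel_measurable M"
  shows "(\<lambda>x. ext_diff (f x) c) \<in> borel_measurable M"
  unfolding ext_diff_def by measurable

text \<open>Gives pointwise convergence of oscillation integrands whose subtracted mean varies. For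
  infinite \<open>a\<close> the expression is constantly \<open>\<infinity>\<close>; otherwise it
  depends continuously on a real number.\<close>

lemma tendsto_ennpowr_ext_diff:
  assumes m: "(m \<longlongrightarrow> c) F" and q: "0 < q"
  shows "((\<lambda>n. ennpowr (ext_diff a (ereal (m n))) q) \<longlongrightarrow> ennpowr (ext_diff a (ereal c)) q) F"
proof (cases a)
  case (real t)
  have eq: "ext_diff a (ereal s) = ennreal \<bar>t - s\<bar>" for s
    by (simp add: ext_diff_def real)
  show ?thesis unfolding eq
    by (intro tendsto_ennpowr tendsto_ennrealI tendsto_intros m q) auto
qed (auto simp: ext_diff_def)

section \<open>Integrals over sets\<close>

lemma measurable_times_indicator:
  fixes u :: "'a \<Rightarrow> ereal"
  assumes "integrable_over M A u" "A \<in> sets M"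
  shows "(\<lambda>x. u x * indicator A x) \<in> borel_measurable M"
  using assms by (simp add: integrable_over_def borel_measurable_restrict_space_iff_ereal)

lemma integrable_over_mono:
  assumes u: "integrable_over M A u" and "B \<subseteq> A"
  shows "integrable_over M B u"
proof -
  have "(\<integral>\<^sup>+x\<in>B. e2ennreal \<bar>u x\<bar> \<partial>M) \<le> (\<integral>\<^sup>+x\<in>A. e2ennreal \<bar>u x\<bar> \<partial>M)"
    using assms(2) by (intro nn_integral_mono) (auto split: split_indicator)
  then show ?thesis
    using u measurable_restrict_mono[OF _ assms(2)] unfolding integrable_over_def by (auto intro: le_less_trans)
qed

lemma measurable_oscillation:
  assumes "integrable_over M A u" "A \<in> sets M"
  shows "(\<lambda>y. ennpowr (ext_diff (u y) c) q * indicator A y) \<in> borel_measurable M"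
proof -
  have [measurable]: "(\<lambda>x. u x * indicator A x) \<in> borel_measurable M" "A \<in> sets M"
    using measurable_times_indicator assms by auto
  \<comment> \<open>Outside \<open>A\<close> nothing is known about \<open>u\<close>, so it is cut
    off inside the power as well; the outer indicator hides the change.\<close>
  have "(\<lambda>y. ennpowr (ext_diff (u y * indicator A y) c) q * indicator A y) \<in> borel_measurable M"
    by measurable
  also have "(\<lambda>y. ennpowr (ext_diff (u y * indicator A y) c) q * indicator A y)
      = (\<lambda>y. ennpowr (ext_diff (u y) c) q * indicator A y)"
    by (auto split: split_indicator)
  finally show ?thesis .
qed

lemma set_integrable_real_of_ereal:
  assumes u: "integrable_over M A u" and A: "A \<in> sets M"
  shows "set_integrable M A (\<lambda>x. real_of_ereal (u x))"
proof -
  have [measurable]: "(\<lambda>x. u x * indicator A x) \<in> borel_measurable M"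
    using measurable_times_indicator assms by auto
  have eq: "(\<lambda>x. indicator A x *\<^sub>R real_of_ereal (u x)) = (\<lambda>x. real_of_ereal (u x * indicator A x))"
    by (auto split: split_indicator)
  have "(\<integral>\<^sup>+x. ennreal (norm (real_of_ereal (u x * indicator A x))) \<partial>M)
      \<le> (\<integral>\<^sup>+x\<in>A. e2ennreal \<bar>u x\<bar> \<partial>M)"
  proof (rule nn_integral_mono)
    fix x
    show "ennreal (norm (real_of_ereal (u x * indicator A x))) \<le> e2ennreal \<bar>u x\<bar> * indicator A x"
      \<comment> \<open>Equality holds except at infinite values on \<open>A\<close>, where
        \<open>real_of_ereal\<close> is 0.\<close>
      by (cases "u x") (auto split: split_indicator)
  qed
  also have "\<dots> < \<infinity>" using u by (simp add: integrable_over_def)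
  finally show ?thesis
    unfolding set_integrable_def eq by (intro integrableI_bounded) measurable
qed

text \<open>Dominated convergence with majorant \<open>f\<close> on \<open>A\<close>. The
  approximating balls used later are in general not nested, hence the pointwise form of exhaustion.
  The choice \<open>f = 1\<close> yields convergence of measures.\<close>

lemma tendsto_set_nn_integral:
  fixes f :: "'a \<Rightarrow> ennreal"
  assumes f: "f \<in> borel_measurable M" and A: "A \<in> sets M" "\<And>n. B n \<in> sets M" "\<And>n. B n \<subseteq> A"
    and fin: "(\<integral>\<^sup>+x\<in>A. f x \<partial>M) < \<infinity>"
    and lim: "\<And>x. x \<in> A \<Longrightarrow> \<forall>\<^sub>F n in sequentially. x \<in> B n"
  shows "(\<lambda>n. \<integral>\<^sup>+x\<in>B n. f x \<partial>M) \<longlonglongrightarrow> (\<integral>\<^sup>+x\<in>A. f x \<partial>M)"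
proof (rule nn_integral_dominated_convergence[where w = "\<lambda>x. f x * indicator A x"])
  show "AE x in M. (\<lambda>n. f x * indicator (B n) x) \<longlonglongrightarrow> f x * indicator A x"
  proof (rule AE_I2)
    fix x
    show "(\<lambda>n. f x * indicator (B n) x) \<longlonglongrightarrow> f x * indicator A x"
    proof (cases "x \<in> A")
      case True
      show ?thesis
        by (rule tendsto_eventually, rule eventually_mono[OF lim[OF True]]) (simp add: True)
    next
      case False
      then have "x \<notin> B n" for n using A by blast
      then show ?thesis using False by simp
    qed
  qed
  show "AE x in M. f x * indicator (B n) x \<le> f x * indicator A x" for n
    using A(3)[of n] by (auto split: split_indicator)
qed (use f A fin in auto)

lemma tendsto_mean:
  assumes u: "integrable_over M A u" and A: "A \<in> sets M" "\<And>n. B n \<in> sets M" "\<And>n. B n \<subseteq> A"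
    and pos: "0 < emeasure M A" and fin: "emeasure M A < \<infinity>"
    and lim: "\<And>x. x \<in> A \<Longrightarrow> \<forall>\<^sub>F n in sequentially. x \<in> B n"
  shows "(\<lambda>n. mean M (B n) u) \<longlonglongrightarrow> mean M A u"
proof -
  have int: "set_integrable M A (\<lambda>x. real_of_ereal (u x))"
    using set_integrable_real_of_ereal[OF u A(1)] .
  have "(\<lambda>n. LINT x:B n|M. real_of_ereal (u x)) \<longlonglongrightarrow> (LINT x:A|M. real_of_ereal (u x))"
    unfolding set_lebesgue_integral_def
  proof (rule integral_dominated_convergence
      [where w = "\<lambda>x. norm (indicator A x *\<^sub>R real_of_ereal (u x))"])
    show "(\<lambda>x. indicator (B n) x *\<^sub>R real_of_ereal (u x)) \<in> borel_measurable M" for n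
      using set_integrable_subset[OF int A(2)[of n] A(3)[of n]]
      unfolding set_integrable_def by simp
    show "AE x in M. (\<lambda>n. indicator (B n) x *\<^sub>R real_of_ereal (u x))
        \<longlonglongrightarrow> indicator A x *\<^sub>R real_of_ereal (u x)"
    proof (rule AE_I2)
      fix x
      show "(\<lambda>n. indicator (B n) x *\<^sub>R real_of_ereal (u x)) \<longlonglongrightarrow> indicator A x *\<^sub>R real_of_ereal (u x)"
      proof (cases "x \<in> A")
        case True
        show ?thesis
          by (rule tendsto_eventually, rule eventually_mono[OF lim[OF True]]) (simp add: True)
      next
        case False
        then have "x \<notin> B n" for n using A by blast
        then show ?thesis using False by simp
      qed
    qed
    show "AE x in M. norm (indicator (B n) x *\<^sub>R real_of_ereal (u x))
        \<le> norm (indicator A x *\<^sub>R real_of_ereal (u x))" for n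
      using A(3)[of n] by (intro AE_I2) (auto simp: real_of_ereal_pos split: split_indicator)
  qed (use int in \<open>auto simp: set_integrable_def\<close>)
  moreover have "(\<lambda>n. measure M (B n)) \<longlonglongrightarrow> measure M A"
    using tendsto_set_nn_integral[of "\<lambda>_. 1" M A B] A fin lim
    unfolding measure_def by (intro tendsto_enn2real) auto
  \<comment> \<open>Finiteness matters here as much as positivity, since \<open>enn2real\<close>
    sends \<open>\<infinity>\<close> to 0.\<close>
  moreover have "measure M A \<noteq> 0"
    using pos fin by (auto simp: measure_def enn2real_eq_0_iff)
  ultimately show ?thesis unfolding mean_def by (intro tendsto_divide)
qed

section \<open>Transfer from a space to its completion\<close>

lemma measurable_extended_measure: "\<iota> \<in> measurable M (extended_measure \<iota> M)"
  by (auto simp: measurable_def sets_extended_measure)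

text \<open>The extended sigma-algebra is the largest one making \<open>\<iota>\<close> measurable,
  and the measure is read off preimages. Integrals over the completion become integrals over X
  through this identity.\<close>

lemma distr_extended_measure: "distr M (extended_measure \<iota> M) \<iota> = extended_measure \<iota> M"
  using measurable_extended_measure[of \<iota> M]
  by (intro measure_eqI)
     (auto simp: emeasure_distr emeasure_extended_measure sets_extended_measure)

lemma nn_integral_extended_measure:
  assumes "f \<in> borel_measurable (extended_measure \<iota> M)"
  shows "(\<integral>\<^sup>+y. f y \<partial>extended_measure \<iota> M) = (\<integral>\<^sup>+x. f (\<iota> x) \<partial>M)"
  by (metis assms distr_extended_measure measurable_extended_measure nn_integral_distr)

text \<open>Measurability is asked of the product because \<open>integrable_over\<close> controls a
  function on \<open>A\<close> only.\<close>

lemma set_nn_integral_extended_measure: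
  assumes "(\<lambda>y. f y * indicator A y) \<in> borel_measurable (extended_measure \<iota> M)"
  shows "(\<integral>\<^sup>+y\<in>A. f y \<partial>extended_measure \<iota> M) = (\<integral>\<^sup>+x\<in>\<iota> -` A. f (\<iota> x) \<partial>M)"
  using nn_integral_extended_measure[OF assms] by (simp add: indicator_def vimage_def)

lemma nn_mean_extended_measure:
  assumes "(\<lambda>y. f y * indicator A y) \<in> borel_measurable (extended_measure \<iota> M)"
    and "A \<in> sets (extended_measure \<iota> M)" and "space M = UNIV"
  shows "nn_mean (extended_measure \<iota> M) A f = nn_mean M (\<iota> -` A) (\<lambda>x. f (\<iota> x))"
  using assms emeasure_extended_measure[of \<iota> A M]
  by (simp add: nn_mean_def set_nn_integral_extended_measure sets_extended_measure)

lemma integrable_over_extended_measure: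
  assumes u: "integrable_over (extended_measure \<iota> M) A u" and A: "A \<in> sets (extended_measure \<iota> M)"
  shows "integrable_over M (\<iota> -` A) (\<lambda>x. u (\<iota> x))"
proof -
  let ?N = "extended_measure \<iota> M"
  have [measurable]: "(\<lambda>x. u x * indicator A x) \<in> borel_measurable ?N" "A \<in> sets ?N"
    using measurable_times_indicator[OF u A] A by auto
  have "\<iota> \<in> measurable (restrict_space M (\<iota> -` A)) (restrict_space ?N A)"
    by (intro measurable_restrict_space3 measurable_extended_measure) auto
  then have "(\<lambda>x. u (\<iota> x)) \<in> borel_measurable (restrict_space M (\<iota> -` A))"
    using u unfolding integrable_over_def by (auto intro: measurable_compose)
  moreover have "(\<lambda>y. e2ennreal \<bar>u y * indicator A y\<bar> * indicator A y) \<in> borel_measurable ?N"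
    by measurable
  then have "(\<lambda>y. e2ennreal \<bar>u y\<bar> * indicator A y) \<in> borel_measurable ?N"
    by (rule measurable_cong[THEN iffD1, rotated]) (auto split: split_indicator)
  ultimately show ?thesis
    using u set_nn_integral_extended_measure[of "\<lambda>y. e2ennreal \<bar>u y\<bar>" A \<iota> M]
    unfolding integrable_over_def by simp
qed

lemma mean_extended_measure:
  assumes u: "integrable_over (extended_measure \<iota> M) A u" and A: "A \<in> sets (extended_measure \<iota> M)"
    and sp: "space M = UNIV"
  shows "mean (extended_measure \<iota> M) A u = mean M (\<iota> -` A) (\<lambda>x. u (\<iota> x))"
proof -
  let ?N = "extended_measure \<iota> M"
  have "(\<lambda>y. indicator A y *\<^sub>R real_of_ereal (u y)) \<in> borel_measurable ?N"
    using set_integrable_real_of_ereal[OF u A] by (auto simp: set_integrable_def)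
  then have "(LINT y:A|?N. real_of_ereal (u y)) = (LINT x:\<iota> -` A|M. real_of_ereal (u (\<iota> x)))"
    using integral_distr[OF measurable_extended_measure[of \<iota> M], of "\<lambda>y. indicator A y *\<^sub>R real_of_ereal (u y)"]
    unfolding set_lebesgue_integral_def distr_extended_measure
    by (simp add: indicator_def vimage_def)
  moreover have "measure ?N A = measure M (\<iota> -` A)"
    using A sp emeasure_extended_measure[of \<iota> A M] by (simp add: measure_def sets_extended_measure)
  ultimately show ?thesis by (simp add: mean_def)
qed

text \<open>Length and continuity are expressed through distances alone.\<close>

lemma arc_length_curve_isometry:
  assumes iso: "\<And>x y. dist (\<iota> x) (\<iota> y) = dist x y" and \<gamma>: "arc_length_curve \<gamma> l"
  shows "arc_length_curve (\<lambda>t. \<iota> (\<gamma> t)) l"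
proof -
  have "curve_length (\<lambda>t. \<iota> (\<gamma> t)) a b = curve_length \<gamma> a b" for a b
    by (simp add: curve_length_def iso)
  moreover have "continuous_on {0..l} (\<lambda>t. \<iota> (\<gamma> t))"
    using \<gamma> by (simp add: arc_length_curve_def continuous_on_iff iso)
  ultimately show ?thesis using \<gamma> by (simp add: arc_length_curve_def)
qed

text \<open>Every curve of X is also a curve of the completion, so the restricted pair is tested on
  fewer curves; continuity of \<open>\<iota>\<close> keeps \<open>g\<close> Borel.\<close>

lemma upper_gradient_isometry:
  fixes \<iota> :: "'a::metric_space \<Rightarrow> 'b::metric_space"
  assumes iso: "\<And>x y. dist (\<iota> x) (\<iota> y) = dist x y" and g: "upper_gradient g u"
  shows "upper_gradient (\<lambda>x. g (\<iota> x)) (\<lambda>x. u (\<iota> x))"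
proof -
  have "continuous_on UNIV \<iota>" by (auto simp: continuous_on_iff iso)
  then have "\<iota> \<in> borel_measurable borel" by (rule borel_measurable_continuous_onI)
  then have "(\<lambda>x. g (\<iota> x)) \<in> borel_measurable borel"
    using g by (auto simp: upper_gradient_def intro: measurable_compose)
  then show ?thesis
    using g arc_length_curve_isometry[of \<iota>, OF iso] unfolding upper_gradient_def by blast
qed

text \<open>Preimages of Borel sets under the continuous map \<open>\<iota>\<close> are Borel. This
  makes balls of the completion and Borel upper gradients on it measurable for the extended
  measure.\<close>

lemma borel_subset_extended_measure:
  fixes \<iota> :: "'a::metric_space \<Rightarrow> 'b::metric_space"
  assumes iso: "\<And>x y. dist (\<iota> x) (\<iota> y) = dist x y" and M: "metric_measure_space M"
  shows "sets borel \<subseteq> sets (extended_measure \<iota> M)"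
proof
  fix E :: "'b set" assume "E \<in> sets borel"
  have "continuous_on UNIV \<iota>" by (auto simp: continuous_on_iff iso)
  then have "\<iota> \<in> borel_measurable borel" by (rule borel_measurable_continuous_onI)
  then have "\<iota> -` E \<in> sets borel"
    using \<open>E \<in> sets borel\<close> by (auto dest: measurable_sets)
  then show "E \<in> sets (extended_measure \<iota> M)"
    using M by (auto simp: sets_extended_measure metric_measure_space_def)
qed

text \<open>For a centre in the image, the preimages of both balls are balls of X with the same
  radii. Each average thus equals the corresponding one over X, and the constants do not
  change.\<close>

lemma poincare_extended_at_image:
  fixes \<iota> :: "'a::metric_space \<Rightarrow> 'b::metric_space"
  assumes iso: "\<And>x y. dist (\<iota> x) (\<iota> y) = dist x y" and M: "metric_measure_space M"
    and PI: "poincare_within M q p C \<Lambda> x\<^sub>0 r\<^sub>0"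
    and r: "0 < r" and sub: "ball (\<iota> z) r \<subseteq> ball (\<iota> x\<^sub>0) r\<^sub>0"
    and u: "integrable_over (extended_measure \<iota> M) (ball (\<iota> z) (\<Lambda> * r)) u"
    and g: "upper_gradient g u"
  shows "ennpowr (nn_mean (extended_measure \<iota> M) (ball (\<iota> z) r)
            (\<lambda>y. ennpowr (ext_diff (u y) (ereal (mean (extended_measure \<iota> M) (ball (\<iota> z) r) u))) q)) (1 / q)
        \<le> ennreal (C * r) *
            ennpowr (nn_mean (extended_measure \<iota> M) (ball (\<iota> z) (\<Lambda> * r)) (\<lambda>y. ennpowr (g y) p)) (1 / p)"
proof -
  let ?N = "extended_measure \<iota> M"
  have ball: "\<iota> -` ball (\<iota> x) s = ball x s" for x s by (auto simp: iso)
  have sp: "space M = UNIV" using M by (simp add: metric_measure_space_def)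
  have S: "ball y s \<in> sets ?N" for y s
    using borel_subset_extended_measure[of \<iota>, OF iso M] by auto
  have "1 \<le> \<Lambda>" using PI by (simp add: poincare_within_def)
  then have "ball (\<iota> z) r \<subseteq> ball (\<iota> z) (\<Lambda> * r)" using r by (intro subset_ball) auto
  then have u': "integrable_over ?N (ball (\<iota> z) r) u" using integrable_over_mono u by blast
  have "g \<in> borel_measurable borel" using g by (simp add: upper_gradient_def)
  then have [measurable]: "g \<in> borel_measurable ?N"
    using borel_subset_extended_measure[of \<iota>, OF iso M] by (auto simp: measurable_def)
  have "ball z r \<subseteq> ball x\<^sub>0 r\<^sub>0" using sub ball by (metis vimage_mono)
  then have "ennpowr (nn_mean M (ball z r)
            (\<lambda>y. ennpowr (ext_diff (u (\<iota> y)) (ereal (mean M (ball z r) (\<lambda>x. u (\<iota> x))))) q)) (1 / q)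
        \<le> ennreal (C * r) *
            ennpowr (nn_mean M (ball z (\<Lambda> * r)) (\<lambda>y. ennpowr (g (\<iota> y)) p)) (1 / p)"
    using PI r integrable_over_extended_measure[OF u S] upper_gradient_isometry[of \<iota>, OF iso g]
    unfolding poincare_within_def ball by blast
  moreover have "mean ?N (ball (\<iota> z) r) u = mean M (ball z r) (\<lambda>x. u (\<iota> x))"
    using mean_extended_measure[OF u' S sp] by (simp only: ball)
  moreover have "nn_mean ?N (ball (\<iota> z) r) (\<lambda>y. ennpowr (ext_diff (u y) c) q)
      = nn_mean M (ball z r) (\<lambda>y. ennpowr (ext_diff (u (\<iota> y)) c) q)" for c
    using nn_mean_extended_measure[OF measurable_oscillation[OF u' S] S sp] by (simp only: ball)
  moreover have "nn_mean ?N (ball (\<iota> z) (\<Lambda> * r)) (\<lambda>y. ennpowr (g y) p)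
      = nn_mean M (ball z (\<Lambda> * r)) (\<lambda>y. ennpowr (g (\<iota> y)) p)"
    using nn_mean_extended_measure[OF _ S sp, of "\<lambda>y. ennpowr (g y) p"] S by (simp add: ball)
  ultimately show ?thesis by simp
qed

section \<open>Arbitrary centres\<close>

text \<open>With \<open>d = dist x y\<close>, the triangle inequality bounds distances from
  \<open>x\<close> by \<open>d + c * (r - d)\<close>, which is at most \<open>c * r\<close> because
  \<open>c \<ge> 1\<close>. The case \<open>c = 1\<close> serves the balls themselves,
  \<open>c = \<Lambda>\<close> their dilations.\<close>

lemma ball_shrink_subset:
  assumes "1 \<le> c" shows "ball y (c * (r - dist x y)) \<subseteq> ball x (c * r)"
proof
  fix w assume "w \<in> ball y (c * (r - dist x y))"
  moreover have "dist x w \<le> dist x y + dist y w" by (rule dist_triangle)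
  moreover have "1 * dist x y \<le> c * dist x y" using assms by (intro mult_right_mono) auto
  ultimately show "w \<in> ball x (c * r)" by (auto simp: algebra_simps)
qed

lemma eventually_in_ball_shrink:
  assumes y: "y \<longlonglongrightarrow> x" and w: "w \<in> ball x (c * r)"
  shows "\<forall>\<^sub>F n in sequentially. w \<in> ball (y n) (c * (r - dist x (y n)))"
proof -
  \<comment> \<open>The slack in the membership condition converges to
    \<open>c * r - dist x w\<close>, which is positive since the ball is open.\<close>
  have "(\<lambda>n. c * (r - dist x (y n)) - dist (y n) w) \<longlonglongrightarrow> c * (r - dist x x) - dist x w"
    by (intro tendsto_intros y)
  moreover have "0 < c * (r - dist x x) - dist x w" using w by simp
  ultimately have "\<forall>\<^sub>F n in sequentially. 0 < c * (r - dist x (y n)) - dist (y n) w"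
    by (rule order_tendstoD(1))
  then show ?thesis by eventually_elim simp
qed

theorem proposition3p6:
  fixes M :: "'a::metric_space measure"
    and \<iota> :: "'a \<Rightarrow> 'b::complete_space"
    and p q r\<^sub>0 C \<Lambda> :: real
    and x\<^sub>0 :: 'a
  assumes "metric_measure_space M"
    and "is_completion \<iota>"
    and "1 < p" and "1 \<le> q" and "0 < r\<^sub>0"
    and "poincare_within M q p C \<Lambda> x\<^sub>0 r\<^sub>0"
  shows "poincare_within (extended_measure \<iota> M) q p C \<Lambda> (\<iota> x\<^sub>0) r\<^sub>0"
proof -
  note M = assms(1) and PI = assms(6)
  define N where "N = extended_measure \<iota> M"
  have iso: "\<And>x y. dist (\<iota> x) (\<iota> y) = dist x y" and dense: "closure (range \<iota>) = UNIV"
    using assms(2) by (auto simp: is_completion_def)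
  have C: "0 < C" and \<Lambda>: "1 \<le> \<Lambda>" using PI by (auto simp: poincare_within_def)

  \<comment> \<open>Measures of balls in the completion\<close>
  have S: "ball y s \<in> sets N" for y s
    using borel_subset_extended_measure[of \<iota>, OF iso M] by (auto simp: N_def)
  have em: "emeasure N (ball (\<iota> z) s) = emeasure M (ball z s)" for z s
  proof -
    have "\<iota> -` ball (\<iota> z) s = ball z s" by (auto simp: iso)
    moreover have "space M = UNIV" using M by (simp add: metric_measure_space_def)
    ultimately show ?thesis
      using emeasure_extended_measure[of \<iota> "ball (\<iota> z) s" M] S[of "\<iota> z" s]
      by (simp add: N_def sets_extended_measure)
  qed
  \<comment> \<open>Density provides an image point within \<open>s / 2\<close> of \<open>x\<close>;
    the balls of radii \<open>s / 2\<close> and \<open>2 * s\<close> about it sandwich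
    \<open>ball x s\<close>, and by \<open>em\<close> their measures are those of balls of
    X.\<close>
  have emN: "0 < emeasure N (ball x s) \<and> emeasure N (ball x s) < \<infinity>" if s: "0 < s" for x s
  proof -
    have "x \<in> closure (range \<iota>)" using dense by simp
    then obtain z where z: "dist (\<iota> z) x < s / 2"
      using s by (force simp: closure_approachable dest!: spec[of _ "s/2"])
    have "ball (\<iota> z) (s/2) \<subseteq> ball x s" "ball x s \<subseteq> ball (\<iota> z) (2 * s)"
      using z s by (auto simp: subset_eq dist_commute) metric+
    then have "emeasure N (ball (\<iota> z) (s/2)) \<le> emeasure N (ball x s)"
      "emeasure N (ball x s) \<le> emeasure N (ball (\<iota> z) (2 * s))"
      by (auto intro!: emeasure_mono S)
    moreover have "0 < emeasure M (ball z (s/2))" "emeasure M (ball z (2 * s)) < \<infinity>"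
      using M s by (auto simp: metric_measure_space_def)
    ultimately show ?thesis by (auto simp: em intro: less_le_trans le_less_trans)
  qed
  have "ennpowr (nn_mean N (ball x r)
          (\<lambda>y. ennpowr (ext_diff (u y) (ereal (mean N (ball x r) u))) q)) (1 / q)
      \<le> ennreal (C * r) * ennpowr (nn_mean N (ball x (\<Lambda> * r)) (\<lambda>y. ennpowr (g y) p)) (1 / p)"
    if r: "0 < r" and sub: "ball x r \<subseteq> ball (\<iota> x\<^sub>0) r\<^sub>0"
      and u: "integrable_over N (ball x (\<Lambda> * r)) u" and g: "upper_gradient g u" for x r u g
  proof -
    let ?B = "ball x r" and ?D = "ball x (\<Lambda> * r)"
    \<comment> \<open>One fixed numerator over the full dilated ball, bounding the numerators over
      all approximating dilations at once.\<close>
    define J where "J = (\<integral>\<^sup>+y\<in>?D. ennpowr (g y) p \<partial>N)"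
    have \<Lambda>r: "0 < \<Lambda> * r" using \<Lambda> r by simp
    show ?thesis
    proof (cases "J = \<infinity>")
      \<comment> \<open>The right-hand side is infinite: the measure of the dilated ball is finite
        and \<open>C * r\<close> is positive.\<close>
      case True
      then have "nn_mean N ?D (\<lambda>y. ennpowr (g y) p) = \<infinity>"
        using emN[OF \<Lambda>r, of x] by (auto simp: nn_mean_def J_def ennreal_top_divide)
      then show ?thesis using C r by (simp add: ennreal_mult_top)
    next
      case False

      \<comment> \<open>Exhaustion by balls centred in X\<close>
      have "\<exists>z. dist (\<iota> z) x < min r (1 / real (Suc n))" for n
      proof -
        have "x \<in> closure (range \<iota>)" using dense by simp
        moreover have "0 < min r (1 / real (Suc n))" using r by simp
        ultimately show ?thesis unfolding closure_approachable by blast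
      qed
      \<comment> \<open>The bound by \<open>r\<close> keeps the radii \<open>s n\<close> positive;
        the other bound makes the centres converge to \<open>x\<close>.\<close>
      then obtain z where z: "\<And>n. dist (\<iota> (z n)) x < min r (1 / real (Suc n))" by metis
      define y where "y n = \<iota> (z n)" for n
      define s where "s n = r - dist x (y n)" for n
      have "(\<lambda>n. dist (y n) x) \<longlonglongrightarrow> 0"
      proof (rule tendsto_sandwich[OF _ _ tendsto_const LIMSEQ_inverse_real_of_nat])
        show "\<forall>\<^sub>F n in sequentially. dist (y n) x \<le> inverse (real (Suc n))"
          using z by (auto simp: y_def inverse_eq_divide less_imp_le)
      qed auto
      then have y: "y \<longlonglongrightarrow> x" by (rule tendsto_dist_iff[THEN iffD2])
      have s: "0 < s n" "s n \<le> r" for n using z[of n] by (auto simp: s_def y_def dist_commute)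
      define B where "B n = ball (y n) (s n)" for n
      define D where "D n = ball (y n) (\<Lambda> * s n)" for n
      have BB: "B n \<subseteq> ?B" for n
        using ball_shrink_subset[of 1 "y n" r x] by (simp add: B_def s_def)
      have DD: "D n \<subseteq> ?D" for n
        using ball_shrink_subset[OF \<Lambda>] by (simp add: D_def s_def)
      have limB: "\<forall>\<^sub>F n in sequentially. w \<in> B n" if "w \<in> ?B" for w
        using eventually_in_ball_shrink[OF y, of w 1 r] that by (simp add: B_def s_def)
      have limD: "\<forall>\<^sub>F n in sequentially. w \<in> D n" if "w \<in> ?D" for w
        using eventually_in_ball_shrink[OF y, of w \<Lambda> r] that by (simp add: D_def s_def)
      have SB: "B n \<in> sets N" and SD: "D n \<in> sets N" for n by (auto simp: B_def D_def S)
      have "?B \<subseteq> ?D" using \<Lambda> r by (intro subset_ball) auto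
      then have uB: "integrable_over N ?B u" using integrable_over_mono u by blast
      have m: "(\<lambda>n. mean N (B n) u) \<longlonglongrightarrow> mean N ?B u"
        using emN[OF r] by (intro tendsto_mean uB S SB BB limB) auto
      have eB: "(\<lambda>n. emeasure N (B n)) \<longlonglongrightarrow> emeasure N ?B"
        using tendsto_set_nn_integral[of "\<lambda>_. 1" N ?B B] emN[OF r, of x] BB SB S limB by simp
      have eD: "(\<lambda>n. emeasure N (D n)) \<longlonglongrightarrow> emeasure N ?D"
        using tendsto_set_nn_integral[of "\<lambda>_. 1" N ?D D] emN[OF \<Lambda>r, of x] DD SD S limD by simp

      \<comment> \<open>Estimate on the approximating balls\<close>
      define F where "F c w = ennpowr (ext_diff (u w) (ereal c)) q" for c w
      \<comment> \<open>Compared with the inequality on the \<open>n\<close>-th ball, the radius is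
        enlarged to \<open>r\<close> and the numerator to \<open>J\<close>, so only the measure of
        \<open>D n\<close> still depends on \<open>n\<close>.\<close>
      define R where "R n = ennreal (C * r) * ennpowr (J / emeasure N (D n)) (1 / p)" for n
      define R' where "R' = ennreal (C * r) * ennpowr (J / emeasure N ?D) (1 / p)"
      have J: "J / emeasure N ?D < \<infinity>"
        using False emN[OF \<Lambda>r, of x]
        by (cases J; cases "emeasure N ?D") (auto simp: divide_ennreal)
      have "(\<lambda>n. J / emeasure N (D n)) \<longlonglongrightarrow> J / emeasure N ?D"
        using False by (intro tendsto_cdivide_ennreal eD) (simp add: less_top)
      then have R: "R \<longlonglongrightarrow> R'"
        unfolding R_def R'_def using J assms(3)
        by (intro ennreal_tendsto_cmult tendsto_ennpowr) auto
      have R'fin: "R' < \<infinity>"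
        using J unfolding R'_def by (auto simp: ennpowr_def ennreal_mult_less_top)
      have "(\<integral>\<^sup>+w\<in>B n. F (mean N (B n) u) w \<partial>N) \<le> emeasure N (B n) * ennpowr (R n) q" for n
      proof -
        have "ennpowr (nn_mean N (B n) (F (mean N (B n) u))) (1 / q)
            \<le> ennreal (C * s n) * ennpowr (nn_mean N (D n) (\<lambda>y. ennpowr (g y) p)) (1 / p)"
          using poincare_extended_at_image[of \<iota>, OF iso M PI s(1)[of n], of "z n" u g]
            BB[of n] sub integrable_over_mono[OF u DD[of n]] g
          unfolding F_def B_def D_def y_def N_def by blast
        \<comment> \<open>Only the numerator is enlarged; the denominator stays the measure of
          \<open>D n\<close>, whose limit is given by \<open>eD\<close>.\<close>
        also have "nn_mean N (D n) (\<lambda>y. ennpowr (g y) p) \<le> J / emeasure N (D n)"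
          unfolding nn_mean_def J_def using DD[of n]
          by (intro divide_right_mono_ennreal nn_integral_mono) (auto split: split_indicator)
        then have "ennreal (C * s n) * ennpowr (nn_mean N (D n) (\<lambda>y. ennpowr (g y) p)) (1 / p) \<le> R n"
          unfolding R_def using C s[of n] assms(3)
          by (intro mult_mono ennreal_leI ennpowr_mono) auto
        \<comment> \<open>Raising to the power \<open>q\<close> and then multiplying by the measure
          of \<open>B n\<close> leaves a plain integral, the form suited to Fatou's lemma.\<close>
        finally have "ennpowr (ennpowr (nn_mean N (B n) (F (mean N (B n) u))) (1 / q)) q
            \<le> ennpowr (R n) q"
          using assms(4) by (intro ennpowr_mono) auto
        then have "nn_mean N (B n) (F (mean N (B n) u)) \<le> ennpowr (R n) q"
          using assms(4) by (simp add: ennpowr_ennpowr_inverse)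
        moreover have "0 < emeasure N (B n) \<and> emeasure N (B n) < \<infinity>"
          using emN s by (simp add: B_def)
        ultimately show ?thesis
          unfolding nn_mean_def by (intro divide_le_posD_ennreal) auto
      qed
      note bound = this

      \<comment> \<open>Passage to the limit\<close>
      have "(\<integral>\<^sup>+w\<in>?B. F (mean N ?B u) w \<partial>N)
          \<le> (\<integral>\<^sup>+w. liminf (\<lambda>n. F (mean N (B n) u) w * indicator (B n) w) \<partial>N)"
      proof (rule nn_integral_mono)
        fix w
        show "F (mean N ?B u) w * indicator ?B w
            \<le> liminf (\<lambda>n. F (mean N (B n) u) w * indicator (B n) w)"
        \<comment> \<open>A point of \<open>?B\<close> lies in \<open>B n\<close> for all large
          \<open>n\<close>, so the moving indicator is eventually 1 and the convergent means
          determine the limit; outside \<open>?B\<close> the left side is 0.\<close>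
        proof (cases "w \<in> ?B")
          case True
          have "(\<lambda>n. F (mean N (B n) u) w) \<longlonglongrightarrow> F (mean N ?B u) w"
            unfolding F_def using assms(4) by (intro tendsto_ennpowr_ext_diff m) auto
          then have "(\<lambda>n. F (mean N (B n) u) w * indicator (B n) w) \<longlonglongrightarrow> F (mean N ?B u) w"
            by (rule Lim_transform_eventually) (use limB[OF True] in eventually_elim, simp)
          then show ?thesis using True by (simp add: lim_imp_Liminf)
        qed simp
      qed
      \<comment> \<open>Integrability of \<open>u\<close> gives no majorant for the
        \<open>q\<close>-th powers, hence Fatou's lemma instead of dominated convergence.\<close>
      also have "\<dots> \<le> liminf (\<lambda>n. \<integral>\<^sup>+w\<in>B n. F (mean N (B n) u) w \<partial>N)"
        unfolding F_def
        by (intro nn_integral_liminf measurable_oscillation SB integrable_over_mono[OF uB BB])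
      also have "\<dots> \<le> liminf (\<lambda>n. emeasure N (B n) * ennpowr (R n) q)"
        by (intro Liminf_mono always_eventually allI bound)
      \<comment> \<open>Both limit factors are finite, which excludes the discontinuity of the
        product at \<open>0 * \<infinity>\<close>.\<close>
      also have "(\<lambda>n. emeasure N (B n) * ennpowr (R n) q) \<longlonglongrightarrow> emeasure N ?B * ennpowr R' q"
        using R'fin emN[OF r, of x] assms(4)
        by (intro tendsto_mult_ennreal eB tendsto_ennpowr R) (auto simp: ennpowr_def)
      then have "liminf (\<lambda>n. emeasure N (B n) * ennpowr (R n) q) = emeasure N ?B * ennpowr R' q"
        by (simp add: lim_imp_Liminf)
      finally have "nn_mean N ?B (F (mean N ?B u)) \<le> ennpowr R' q"
        unfolding nn_mean_def using emN[OF r, of x]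
        by (intro divide_le_posI_ennreal) auto
      then have "ennpowr (nn_mean N ?B (F (mean N ?B u))) (1 / q) \<le> ennpowr (ennpowr R' q) (1 / q)"
        using assms(4) by (intro ennpowr_mono) auto
      also have "\<dots> = R'" using assms(4) by (intro ennpowr_ennpowr_inverse) auto
      finally show ?thesis by (simp add: R'_def F_def nn_mean_def J_def)
    qed
  qed
  then show ?thesis
    using C \<Lambda> unfolding poincare_within_def N_def by blast
qed

end
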